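(* For all $w_1, w_2\in\mathbb{N}$ and all $x$, the following identity holds (as an identity of formal power series in $t$): $$\frac{1}{w_1}\sum_{i=0}^{w_1-1}\int_{\mathbb{Z}_p}e^{\left(x_1+w_2x+\frac{w_2}{w_1}i\right)tw_1}\,dx_1=\frac{1}{w_2}\sum_{i=0}^{w_2-1}\int_{\mathbb{Z}_p}e^{\left(x_2+w_1x+\frac{w_1}{w_2}i\right)tw_2}\,dx_2.$$
   Context: Let $p$ be a fixed prime, $\mathbb{Z}_p$ the ring of $p$-adic integers, $\mathbb{C}_p$ the completion of an algebraic closure of $\mathbb{Q}_p$, and $\mathbb{N}$ the positive integers. For a uniformly differentiable function $f:\mathbb{Z}_p\to\mathbb{C}_p$, the $p$-adic invariant (Volkenborn) integral is $$\int_{\mathbb{Z}_p} f(y)\,dy=\lim_{N\to\infty}\frac{1}{p^N}\sum_{y=0}^{p^N-1}f(y).$$ Here $t$ is a formal variable and $x\in\mathbb{C}_p$ is a parameter; integrals of exponentials are taken coefficientwise in $t$, i.e. for $a,b\in\mathbb{C}_p$, $\int_{\mathbb{Z}_p}e^{(ay+b)t}\,dy=\sum_{n\ge 0}\left(\int_{\mathbb{Z}_p}(ay+b)^n\,dy\right)\frac{t^n}{n!}$. *)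

theory Defs
  imports "HOL-Analysis.Analysis" "HOL-Computational_Algebra.Computational_Algebra"
begin

text \<open>
  The absolute value is \<open>\<bar>x\<bar> = dist x 0\<close>; the library reserves \<open>norm\<close> for real normed spaces,
  which excludes the \<open>p\<close>-adic fields.
\<close>

class complete_ultrametric_field = field_char_0 + complete_space +
  assumes dist_add_right: "dist (x + z) (y + z) = dist x y"
    and dist_mult_zero: "dist (x * y) 0 = dist x 0 * dist y 0"
    and dist_ultrametric: "dist x z \<le> max (dist x y) (dist y z)"

definition absval :: "'a::complete_ultrametric_field \<Rightarrow> real" where
  "absval x = dist x 0"

text \<open>
  In a complete field whose absolute value restricts to the \<open>p\<close>-adic absolute value on the rationals, the
  topological closure of the rationals is their completion, that is, \<open>\<rat>\<^sub>p\<close>.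
\<close>

definition padic_rationals :: "'a::complete_ultrametric_field set" where
  "padic_rationals = closure (range of_rat)"

definition padic_algebraic :: "'a::complete_ultrametric_field set" where
  "padic_algebraic =
     {z. \<exists>q. q \<noteq> 0 \<and> (\<forall>i. coeff q i \<in> padic_rationals) \<and> poly q z = 0}"

text \<open>
  The predicate below says that \<open>'a\<close> is a completion of an algebraic closure of \<open>\<rat>\<^sub>p\<close>. This
  determines \<open>'a\<close> as a valued field up to isometric isomorphism. It is a predicate rather than a
  type construction so that \<open>p\<close> can be an ordinary natural number. Multiplicativity
  makes it enough to fix the absolute value on positive integers, normalised by \<open>\<bar>p\<bar> = 1 / p\<close>.
\<close>

definition is_padic_complex :: "nat \<Rightarrow> 'a::complete_ultrametric_field itself \<Rightarrow> bool" where
  "is_padic_complex p _ \<longleftrightarrow>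
     prime p \<and>
     (\<forall>n>0. absval (of_nat n :: 'a) = 1 / real p ^ multiplicity p n) \<and>
     (\<forall>q :: 'a poly. degree q > 0 \<and> (\<forall>i. coeff q i \<in> padic_algebraic) \<longrightarrow>
        (\<exists>z\<in>padic_algebraic. poly q z = 0)) \<and>
     closure (padic_algebraic :: 'a set) = UNIV"

text \<open>
  \<open>\<int>\<^sub>p\<close> is the closure of the natural numbers in \<open>'a\<close>; the integral depends only on the values of
  the integrand at natural numbers. The value is meaningful only when the limit exists, as it
  does for every uniformly differentiable integrand, in particular for polynomial ones.
\<close>

definition volkenborn :: "nat \<Rightarrow> ('a::complete_ultrametric_field \<Rightarrow> 'a) \<Rightarrow> 'a" where
  "volkenborn p f = lim (\<lambda>N. 1 / of_nat (p ^ N) * (\<Sum>y<p ^ N. f (of_nat y)))"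

text \<open>
  The integral of \<open>exp (g y * t)\<close> over \<open>y \<in> \<int>\<^sub>p\<close>, as a formal power series in \<open>t\<close>, for affine \<open>g\<close>.
\<close>

definition volkenborn_exp ::
  "nat \<Rightarrow> ('a::complete_ultrametric_field \<Rightarrow> 'a) \<Rightarrow> 'a fps" where
  "volkenborn_exp p g = Abs_fps (\<lambda>n. volkenborn p (\<lambda>y. g y ^ n) / fact n)"

end

theory Submission
  imports Defs
begin

text \<open>
  The partial sums \<open>\<Sum>y<m. f y\<close> of a polynomial \<open>f\<close> are \<open>m Q(m)\<close> for a polynomial \<open>Q\<close>, so their
  averages tend to \<open>Q(0)\<close> along any sequence of integers \<open>m\<close> that tends to \<open>0\<close> \<open>p\<close>-adically. The
  integral on the left may therefore be computed along \<open>m = w2 p^N\<close> and the one on the right along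
  \<open>m = w1 p^N\<close>. Splitting the summation index modulo \<open>w2\<close> and \<open>w1\<close> respectively turns both sides
  into the average of \<open>(w1 j + w2 i + w1 w2 k + w1 w2 x)^n\<close> over \<open>i < w1\<close>, \<open>j < w2\<close>, \<open>k < p^N\<close>.
\<close>

text \<open>Summing \<open>(y + 1)^(k + 1) - y^(k + 1)\<close> over \<open>y < m\<close> telescopes
  to \<open>m^(k + 1)\<close>, while its binomial expansion involves only power sums of exponent at
  most \<open>k\<close>. The one of exponent \<open>k\<close> has coefficient \<open>k + 1\<close>,
  which is invertible in characteristic 0, so it can be solved for.\<close>

lemma power_sum_polynomial:
  "\<exists>S :: 'a::field_char_0 poly. \<forall>m. poly S (of_nat m) = (\<Sum>y<m. of_nat y ^ k)"
proof (induction k rule: less_induct)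
  case (less k)
  then obtain S :: "nat \<Rightarrow> 'a poly"
    where S: "\<And>j m. j < k \<Longrightarrow> poly (S j) (of_nat m) = (\<Sum>y<m. of_nat y ^ j)"
    by metis
  define T where "T = smult (1 / of_nat (Suc k))
    (monom 1 (Suc k) - (\<Sum>j<k. smult (of_nat (Suc k choose j)) (S j)))"
  have "poly T (of_nat m) = (\<Sum>y<m. of_nat y ^ k)" for m
  proof -
    \<comment> \<open>The top binomial term cancels against \<open>y^(k + 1)\<close>; the term
      \<open>j = k\<close> is kept apart because it is the one to be solved for.\<close>
    have step: "of_nat (Suc y) ^ Suc k - of_nat y ^ Suc k =
        (\<Sum>j<k. of_nat (Suc k choose j) * of_nat y ^ j) + of_nat (Suc k) * (of_nat y ^ k :: 'a)" for y
    proof -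
      have "of_nat (Suc y) ^ Suc k = (of_nat y + 1 :: 'a) ^ Suc k"
        by (simp add: add.commute)
      also have "\<dots> = (\<Sum>j<Suc (Suc k). of_nat (Suc k choose j) * of_nat y ^ j)"
        by (simp only: binomial_ring power_one mult_1_right lessThan_Suc_atMost)
      finally show ?thesis
        by (simp add: algebra_simps del: power_Suc)
    qed
    have "of_nat m ^ Suc k = (\<Sum>y<m. of_nat (Suc y) ^ Suc k - of_nat y ^ Suc k :: 'a)"
      by (subst sum_lessThan_telescope) simp
    also have "\<dots> = (\<Sum>j<k. of_nat (Suc k choose j) * poly (S j) (of_nat m))
        + of_nat (Suc k) * (\<Sum>y<m. of_nat y ^ k)"
      unfolding step sum.distrib sum_distrib_left[symmetric]
      by (subst sum.swap) (simp add: S sum_distrib_left)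
    finally show ?thesis
      by (simp add: T_def poly_sum poly_monom field_simps del: power_Suc of_nat_Suc)
  qed
  then show ?case by blast
qed

lemma partial_sum_polynomial:
  fixes f :: "'a::field_char_0 poly"
  shows "\<exists>Q. \<forall>m. (\<Sum>y<m. poly f (of_nat y)) = of_nat m * poly Q (of_nat m)"
proof -
  obtain S :: "nat \<Rightarrow> 'a poly"
    where S: "\<And>k m. poly (S k) (of_nat m) = (\<Sum>y<m. of_nat y ^ k)"
    using power_sum_polynomial by metis
  define T where "T = (\<Sum>k\<le>degree f. smult (coeff f k) (S k))"
  have T: "poly T (of_nat m) = (\<Sum>y<m. poly f (of_nat y))" for m
    unfolding T_def poly_altdef[of f]
    by (subst sum.swap) (simp add: poly_sum S sum_distrib_left)
  \<comment> \<open>The empty sum at \<open>m = 0\<close> gives a root at 0, which is what allows a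
    factor \<open>m\<close> to be split off.\<close>
  have "poly T 0 = 0"
    using T[of 0] by simp
  then obtain Q where "T = [:0, 1:] * Q"
    by (auto simp: poly_eq_0_iff_dvd elim: dvdE)
  then have "(\<Sum>y<m. poly f (of_nat y)) = of_nat m * poly Q (of_nat m)" for m
    by (simp flip: T)
  then show ?thesis by blast
qed

text \<open>The absolute value is multiplicative, so the claim reduces to a product of real
  sequences of distances to 0.\<close>

lemma tendsto_mult_zero_ultrametric:
  fixes X Y :: "nat \<Rightarrow> 'a::complete_ultrametric_field"
  assumes "X \<longlonglongrightarrow> 0" and "Y \<longlonglongrightarrow> L"
  shows "(\<lambda>N. X N * Y N) \<longlonglongrightarrow> 0"
proof -
  have "(\<lambda>N. dist (X N) 0 * dist (Y N) 0) \<longlonglongrightarrow> dist 0 (0 :: 'a) * dist L 0"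
    by (intro tendsto_intros assms)
  then show ?thesis
    by (subst tendsto_dist_iff) (simp add: dist_mult_zero)
qed

text \<open>Horner induction: the value differs from the constant coefficient \<open>a\<close> by
  \<open>X N * poly Q (X N)\<close>, a null sequence times a convergent one, and distances are
  translation invariant.\<close>

lemma tendsto_poly_zero_ultrametric:
  fixes X :: "nat \<Rightarrow> 'a::complete_ultrametric_field"
  assumes "X \<longlonglongrightarrow> 0"
  shows "(\<lambda>N. poly Q (X N)) \<longlonglongrightarrow> poly Q 0"
proof (induction Q)
  case 0
  then show ?case by simp
next
  case (pCons a Q)
  have "(\<lambda>N. X N * poly Q (X N)) \<longlonglongrightarrow> 0"
    using assms pCons.IH by (rule tendsto_mult_zero_ultrametric)
  then have "(\<lambda>N. dist (X N * poly Q (X N)) 0) \<longlonglongrightarrow> 0"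
    by (subst (asm) tendsto_dist_iff)
  moreover have "dist (a + z) a = dist z 0" for z
    using dist_add_right[of z a 0] by (simp add: add.commute)
  ultimately show ?case
    by (subst tendsto_dist_iff) simp
qed

lemma of_nat_prime_power_tendsto_zero:
  assumes "is_padic_complex p TYPE('a::complete_ultrametric_field)"
  shows "(\<lambda>N. of_nat (p ^ N) :: 'a) \<longlonglongrightarrow> 0"
proof -
  have p: "prime p" and
    absval: "\<And>n. n > 0 \<Longrightarrow> absval (of_nat n :: 'a) = 1 / real p ^ multiplicity p n"
    using assms unfolding is_padic_complex_def by auto
  have "dist (of_nat (p ^ N) :: 'a) 0 = inverse (real p) ^ N" for N
    using absval[of "p ^ N"] p
    by (simp add: absval_def prime_gt_0_nat multiplicity_same_power inverse_eq_divide
        power_one_over not_prime_unit del: of_nat_power)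
  moreover have "(\<lambda>N. inverse (real p) ^ N) \<longlonglongrightarrow> 0"
    using prime_gt_1_nat[OF p] by (intro LIMSEQ_realpow_zero) (auto simp: field_simps)
  ultimately show ?thesis
    by (subst tendsto_dist_iff) simp
qed

text \<open>The average over \<open>y < m\<close> equals \<open>poly Q m\<close> for
  \<open>m > 0\<close>, and \<open>m = w * p ^ N\<close> tends to 0 for every fixed
  \<open>w\<close>. The limit \<open>poly Q 0\<close> is therefore independent of
  \<open>w\<close>.\<close>

lemma volkenborn_poly_tendsto:
  fixes f :: "'a::complete_ultrametric_field poly"
  assumes "is_padic_complex p TYPE('a)" and "w > 0"
  shows "(\<lambda>N. 1 / of_nat (w * p ^ N) * (\<Sum>y<w * p ^ N. poly f (of_nat y)))
    \<longlonglongrightarrow> volkenborn p (poly f)"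
proof -
  obtain Q where Q: "\<And>m. (\<Sum>y<m. poly f (of_nat y)) = of_nat m * poly Q (of_nat m)"
    using partial_sum_polynomial[of f] by blast
  have "p > 0"
    using assms(1) by (simp add: is_padic_complex_def prime_gt_0_nat)
  have lim: "(\<lambda>N. 1 / of_nat (v * p ^ N) * (\<Sum>y<v * p ^ N. poly f (of_nat y))) \<longlonglongrightarrow> poly Q 0"
    if "v > 0" for v
  proof -
    have "(\<lambda>N. of_nat (p ^ N) * of_nat v :: 'a) \<longlonglongrightarrow> 0"
      by (rule tendsto_mult_zero_ultrametric)
        (use of_nat_prime_power_tendsto_zero[OF assms(1)] in auto)
    then have "(\<lambda>N. poly Q (of_nat (v * p ^ N))) \<longlonglongrightarrow> poly Q 0"
      using tendsto_poly_zero_ultrametric[of "\<lambda>N. of_nat (v * p ^ N)" Q]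
      by (simp add: mult.commute)
    moreover have "1 / of_nat (v * p ^ N) * (\<Sum>y<v * p ^ N. poly f (of_nat y))
        = poly Q (of_nat (v * p ^ N))" for N
      using \<open>v > 0\<close> \<open>p > 0\<close> unfolding Q by simp
    ultimately show ?thesis by simp
  qed
  \<comment> \<open>The case \<open>v = 1\<close> is the defining sequence of the integral, so it
    identifies the common limit.\<close>
  from lim[of 1] have "volkenborn p (poly f) = poly Q 0"
    unfolding volkenborn_def by (intro limI) simp
  then show ?thesis
    using lim[OF \<open>w > 0\<close>] by simp
qed

lemma tendsto_add_ultrametric:
  fixes X Y :: "nat \<Rightarrow> 'a::complete_ultrametric_field"
  assumes "X \<longlonglongrightarrow> a" and "Y \<longlonglongrightarrow> b"
  shows "(\<lambda>N. X N + Y N) \<longlonglongrightarrow> a + b"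
proof -
  have le: "dist (X N + Y N) (a + b) \<le> dist (X N) a + dist (Y N) b" for N
    \<comment> \<open>Passing through \<open>a + Y N\<close> changes one summand at a time, and each
      leg is a translate of a distance already controlled.\<close>
    using dist_triangle[of "X N + Y N" "a + b" "a + Y N"]
      dist_add_right[of "X N" "Y N" a] dist_add_right[of "Y N" a b]
    by (simp add: add.commute)
  have "(\<lambda>N. dist (X N) a + dist (Y N) b) \<longlonglongrightarrow> 0"
    using tendsto_add[OF assms[THEN tendsto_dist_iff[THEN iffD1]]] by simp
  then have "(\<lambda>N. dist (X N + Y N) (a + b)) \<longlonglongrightarrow> 0"
    using tendsto_sandwich[of "\<lambda>_. 0" "\<lambda>N. dist (X N + Y N) (a + b)" sequentially
        "\<lambda>N. dist (X N) a + dist (Y N) b" 0] le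
    by simp
  then show ?thesis
    by (subst tendsto_dist_iff)
qed

lemma tendsto_sum_ultrametric:
  fixes X :: "'i \<Rightarrow> nat \<Rightarrow> 'a::complete_ultrametric_field"
  assumes "\<And>i. i \<in> I \<Longrightarrow> X i \<longlonglongrightarrow> L i"
  shows "(\<lambda>N. \<Sum>i\<in>I. X i N) \<longlonglongrightarrow> (\<Sum>i\<in>I. L i)"
  using assms
  by (induction I rule: infinite_finite_induct) (auto intro: tendsto_add_ultrametric)

lemma tendsto_mult_left_ultrametric:
  fixes X :: "nat \<Rightarrow> 'a::complete_ultrametric_field"
  assumes "X \<longlonglongrightarrow> a"
  shows "(\<lambda>N. c * X N) \<longlonglongrightarrow> c * a"
proof -
  have shift: "dist u v = dist (u - v) 0" for u v :: 'a
    using dist_add_right[of u "- v" v] by simp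
  have "dist (c * X N) (c * a) = dist c 0 * dist (X N) a" for N
    by (metis shift dist_mult_zero right_diff_distrib)
  moreover have "(\<lambda>N. dist c 0 * dist (X N) a) \<longlonglongrightarrow> dist c 0 * dist a a"
    by (intro tendsto_intros assms)
  ultimately show ?thesis
    by (subst tendsto_dist_iff) simp
qed

text \<open>Division with remainder by \<open>w\<close>: each block of \<open>w\<close> consecutive
  indices has a fixed quotient \<open>k\<close>, and \<open>j\<close> runs over the
  remainders.\<close>

lemma sum_lessThan_mult:
  "(\<Sum>y<w * m. h y) = (\<Sum>k<m. \<Sum>j<w. h (j + w * k :: nat) :: 'a::comm_monoid_add)"
proof (induction m)
  case (Suc m)
  have "(\<Sum>y<w * m + w. h y) = (\<Sum>y<w * m. h y) + (\<Sum>j<w. h (j + w * m))"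
    using sum.atLeastLessThan_concat[of 0 "w * m" "w * m + w" h]
      sum.shift_bounds_nat_ivl[of h 0 "w * m" w]
    by (simp add: atLeast0LessThan add.commute)
  then show ?case
    using Suc by (simp add: add.commute)
qed simp

text \<open>Each integral is taken along \<open>w2 * p ^ N\<close>, so that writing
  \<open>y = j + w2 * k\<close> turns \<open>w1 * y\<close> into
  \<open>w1 * j + w1 * w2 * k\<close>. The resulting average is symmetric under exchanging
  \<open>w1\<close> with \<open>w2\<close> and \<open>i\<close> with \<open>j\<close>.\<close>

lemma volkenborn_power_sum_tendsto:
  fixes c :: "'a::complete_ultrametric_field"
  assumes "is_padic_complex p TYPE('a)" and "w1 > 0" and "w2 > 0"
  shows "(\<lambda>N. 1 / of_nat (w1 * w2 * p ^ N) * (\<Sum>k<p ^ N. \<Sum>i<w1. \<Sum>j<w2.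
        (of_nat (w1 * j + w2 * i + w1 * w2 * k) + c) ^ n))
    \<longlonglongrightarrow> 1 / of_nat w1 * (\<Sum>i<w1. volkenborn p (\<lambda>y. (of_nat w1 * y + of_nat (w2 * i) + c) ^ n))"
    (is "?A \<longlonglongrightarrow> _")
proof -
  define f where "f i = [:of_nat (w2 * i) + c, of_nat w1:] ^ n" for i
  have f: "poly (f i) = (\<lambda>y. (of_nat w1 * y + of_nat (w2 * i) + c) ^ n)" for i
    by (simp add: f_def fun_eq_iff algebra_simps)
  have "(\<lambda>N. 1 / of_nat w1 *
      (\<Sum>i<w1. 1 / of_nat (w2 * p ^ N) * (\<Sum>y<w2 * p ^ N. poly (f i) (of_nat y))))
    \<longlonglongrightarrow> 1 / of_nat w1 * (\<Sum>i<w1. volkenborn p (poly (f i)))"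
    by (intro tendsto_mult_left_ultrametric tendsto_sum_ultrametric
        volkenborn_poly_tendsto assms)
  moreover have "1 / of_nat w1 *
      (\<Sum>i<w1. 1 / of_nat (w2 * p ^ N) * (\<Sum>y<w2 * p ^ N. poly (f i) (of_nat y))) = ?A N" for N
  proof -
    have "(\<Sum>i<w1. \<Sum>y<w2 * p ^ N. poly (f i) (of_nat y)) = (\<Sum>k<p ^ N. \<Sum>i<w1. \<Sum>j<w2.
        (of_nat (w1 * j + w2 * i + w1 * w2 * k) + c) ^ n)"
      unfolding sum_lessThan_mult
      by (subst sum.swap) (simp add: f algebra_simps)
    then show ?thesis
      by (simp flip: sum_distrib_left sum_divide_distrib add: mult.assoc)
  qed
  ultimately show ?thesis
    by (simp add: f)
qed

theorem theorem3:
  fixes p w1 w2 :: nat and x :: "'a::complete_ultrametric_field"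
  assumes "is_padic_complex p TYPE('a)"
    and "w1 > 0" and "w2 > 0"
  shows "fps_const (1 / of_nat w1) *
           (\<Sum>i<w1. volkenborn_exp p
              (\<lambda>x1. (x1 + of_nat w2 * x + of_nat w2 / of_nat w1 * of_nat i) * of_nat w1)) =
         fps_const (1 / of_nat w2) *
           (\<Sum>i<w2. volkenborn_exp p
              (\<lambda>x2. (x2 + of_nat w1 * x + of_nat w1 / of_nat w2 * of_nat i) * of_nat w2))"
proof (rule fps_ext)
  fix n
  \<comment> \<open>After multiplying out, the parameter enters both integrands through this same
    symmetric constant. The \<open>n\<close>-th coefficients of the two sides are then
    \<open>V w1 w2\<close> and \<open>V w2 w1\<close> divided by \<open>fact n\<close>.\<close>
  define c where "c = of_nat (w1 * w2) * x"
  define V where "V v w = 1 / of_nat v *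
    (\<Sum>i<v. volkenborn p (\<lambda>y. (of_nat v * y + of_nat (w * i) + c) ^ n))" for v w
  have "V w1 w2 = V w2 w1"
  proof (rule LIMSEQ_unique)
    show "(\<lambda>N. 1 / of_nat (w1 * w2 * p ^ N) * (\<Sum>k<p ^ N. \<Sum>i<w1. \<Sum>j<w2.
        (of_nat (w1 * j + w2 * i + w1 * w2 * k) + c) ^ n)) \<longlonglongrightarrow> V w1 w2"
      unfolding V_def using assms by (rule volkenborn_power_sum_tendsto)
    \<comment> \<open>Exchanging the two inner sums and renaming the indices shows that both limits
      belong to one sequence.\<close>
    have "(\<Sum>i<w1. \<Sum>j<w2. (of_nat (w1 * j + w2 * i + w1 * w2 * k) + c) ^ n) =
        (\<Sum>i<w2. \<Sum>j<w1. (of_nat (w2 * j + w1 * i + w2 * w1 * k) + c) ^ n)" for k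
      by (subst sum.swap) (simp add: ac_simps)
    then show "(\<lambda>N. 1 / of_nat (w1 * w2 * p ^ N) * (\<Sum>k<p ^ N. \<Sum>i<w1. \<Sum>j<w2.
        (of_nat (w1 * j + w2 * i + w1 * w2 * k) + c) ^ n)) \<longlonglongrightarrow> V w2 w1"
      using volkenborn_power_sum_tendsto[OF assms(1,3,2), of c n]
      unfolding V_def by (simp only: mult.commute[of w1 w2])
  qed
  moreover have integrand1: "(y + of_nat w2 * x + of_nat w2 / of_nat w1 * of_nat i) * of_nat w1
      = of_nat w1 * y + of_nat (w2 * i) + c"
    and integrand2: "(y + of_nat w1 * x + of_nat w1 / of_nat w2 * of_nat i) * of_nat w2
      = of_nat w2 * y + of_nat (w1 * i) + c" for y i
    using assms(2,3) by (simp_all add: c_def field_simps)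
  ultimately show "fps_nth (fps_const (1 / of_nat w1) *
           (\<Sum>i<w1. volkenborn_exp p
              (\<lambda>x1. (x1 + of_nat w2 * x + of_nat w2 / of_nat w1 * of_nat i) * of_nat w1))) n =
         fps_nth (fps_const (1 / of_nat w2) *
           (\<Sum>i<w2. volkenborn_exp p
              (\<lambda>x2. (x2 + of_nat w1 * x + of_nat w1 / of_nat w2 * of_nat i) * of_nat w2))) n"
    unfolding integrand1 integrand2
    by (simp add: volkenborn_exp_def fps_sum_nth V_def flip: sum_divide_distrib)
qed

end
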